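(* Let $r,s,t$ be positive integers with $1 \leq t \leq r \leq s$, and let \[n_0(r,s,t) = \max\left\{r(s-t) {r+s-t \choose t}, \, (r-t){r \choose t} {r+s-t \choose t+1}\right\} + t+1.\] Let $n \geq n_0(r,s,t)$. If $\mathcal{A} \subseteq {[n] \choose r}$ and $\mathcal{B} \subseteq {[n] \choose s}$ are cross-$t$-intersecting, then \[|\mathcal{A}||\mathcal{B}| \leq {n-t \choose r-t}{n-t \choose s-t},\] and equality holds if and only if for some $T \in {[n] \choose t}$, $\mathcal{A} = \{A \in {[n] \choose r} \colon T \subseteq A\}$ and $\mathcal{B} = \{B \in {[n] \choose s} \colon T \subseteq B\}$.
   Context: $[n] = \{1,\dots,n\}$ and ${X \choose r}$ denotes the family of all $r$-element subsets of $X$. Families $\mathcal{A}$ and $\mathcal{B}$ are cross-$t$-intersecting if $|A \cap B| \geq t$ for every $A \in \mathcal{A}$ and every $B \in \mathcal{B}$. The families $\mathcal{A},\mathcal{B}$ may be empty. *)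

theory Defs
  imports Main "HOL-Library.Ramsey"
begin

definition cross_intersecting :: "nat \<Rightarrow> 'a set set \<Rightarrow> 'a set set \<Rightarrow> bool" where
  "cross_intersecting t \<A> \<B> \<longleftrightarrow> (\<forall>A\<in>\<A>. \<forall>B\<in>\<B>. t \<le> card (A \<inter> B))"

text \<open>Only used for \<open>t \<le> r \<le> s\<close>, where none of the natural-number subtractions truncates.\<close>

definition n0 :: "nat \<Rightarrow> nat \<Rightarrow> nat \<Rightarrow> nat" where
  "n0 r s t =
     max (r * (s - t) * ((r + s - t) choose t))
         ((r - t) * (r choose t) * ((r + s - t) choose (t + 1))) + t + 1"

end

theory Submission
  imports Defs
begin

text \<open>
  Call \<open>T\<close>, of size \<open>t\<close>, a kernel of a family if all members contain \<open>T\<close>. Every member of \<open>\<A>\<close>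
  contains a \<open>t\<close>-subset of any fixed \<open>B \<in> \<B>\<close>, so \<open>|\<A>|\<close> is at most \<open>s choose t\<close> times the largest
  number of members of \<open>\<A>\<close> containing a given \<open>T\<close>. If some \<open>B \<in> \<B>\<close> does not contain \<open>T\<close>,
  then each of these members also contains an element of \<open>B - T\<close>, which improves the trivial bound
  \<open>(n - t) choose (r - t)\<close> on their number by a factor \<open>s * (r - t) / (n - t)\<close>. Unless \<open>\<A>\<close> and
  \<open>\<B>\<close> share a kernel, this improvement (or its mirror image) is available at least once, and for
  \<open>n - t > r * (s - t) * ((r + s - t) choose t)\<close> it outweighs the binomial factors.
\<close>

section \<open>Uniform sets through a fixed subset, and union bounds\<close>

definition star :: "'a set \<Rightarrow> nat \<Rightarrow> 'a set \<Rightarrow> 'a set set" where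
  "star X r T = {A \<in> nsets X r. T \<subseteq> A}"

lemma finite_star: "finite X \<Longrightarrow> finite (star X r T)"
  by (simp add: star_def finite_imp_finite_nsets)

lemma card_star:
  assumes "finite X" "T \<subseteq> X" "card T \<le> r"
  shows "card (star X r T) = (card X - card T) choose (r - card T)"
proof -
  have finT: "finite T"
    using assms finite_subset by blast
  have "bij_betw (\<lambda>A. A - T) (star X r T) (nsets (X - T) (r - card T))"
  proof (rule bij_betw_byWitness[where f' = "\<lambda>A. A \<union> T"])
    show "(\<lambda>A. A - T) ` star X r T \<subseteq> nsets (X - T) (r - card T)"
      using finT by (auto simp: star_def nsets_def card_Diff_subset)
    show "(\<lambda>A. A \<union> T) ` nsets (X - T) (r - card T) \<subseteq> star X r T"
    proof clarify
      fix A assume A: "A \<in> nsets (X - T) (r - card T)"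
      then have "A \<inter> T = {}" "finite A"
        by (auto simp: nsets_def)
      then have "card (A \<union> T) = card A + card T"
        using finT by (simp add: card_Un_disjoint)
      then show "A \<union> T \<in> star X r T"
        using A finT assms by (auto simp: star_def nsets_def)
    qed
  qed (auto simp: star_def nsets_def)
  then have "card (star X r T) = card (nsets (X - T) (r - card T))"
    by (rule bij_betw_same_card)
  then show ?thesis
    using assms finT by (simp add: card_nsets card_Diff_subset)
qed

text \<open>The absorption identity
  \<open>Suc k * (Suc m choose Suc k) = Suc m * (m choose k)\<close>, kept multiplied out to avoid
  division. For \<open>card T = r\<close> both sides are zero, since no \<open>r\<close>-set
  contains \<open>insert x T\<close>.\<close>

lemma card_star_insert:
  assumes "finite X" "T \<subseteq> X" "card T \<le> r" "x \<in> X - T"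
  shows "(card X - card T) * card (star X r (insert x T))
    = (r - card T) * ((card X - card T) choose (r - card T))"
proof -
  have finT: "finite T"
    using assms finite_subset by blast
  then have ins: "card (insert x T) = Suc (card T)"
    using assms by simp
  show ?thesis
  proof (cases "card T = r")
    case True
    have "\<not> insert x T \<subseteq> A" if "A \<in> nsets X r" for A
    proof
      assume "insert x T \<subseteq> A"
      moreover have "finite A" "card A = r"
        using that by (auto simp: nsets_def)
      ultimately show False
        using card_mono[of A "insert x T"] ins True by simp
    qed
    then have "star X r (insert x T) = {}"
      by (auto simp: star_def)
    then show ?thesis
      using True by simp
  next
    case False
    then obtain k where k: "r = card T + Suc k"
      using assms(3) by (metis add_Suc_right le_neq_implies_less less_imp_Suc_add)
    have "card (insert x T) \<le> card X"
      using assms by (intro card_mono) auto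
    then obtain m where m: "card X = card T + Suc m"
      unfolding ins by (metis Suc_le_lessD add_Suc_right less_imp_Suc_add)
    have "card (star X r (insert x T)) = m choose k"
      using card_star[of X "insert x T" r] assms ins k m by simp
    then show ?thesis
      using k m Suc_times_binomial[of k m] by simp
  qed
qed

text \<open>Each member of \<open>F\<close> contains \<open>T\<close> and, because \<open>T\<close>
  is not inside \<open>C\<close>, needs some element of \<open>C\<close> outside \<open>T\<close> to
  reach \<open>card T\<close> common elements. So the sets \<open>star X r (insert x T)\<close> with
  \<open>x\<close> in \<open>C - T\<close> cover \<open>F\<close>.\<close>

lemma card_le_of_not_kernel:
  assumes X: "finite X" and T: "T \<subseteq> X" "card T \<le> r"
    and C: "C \<subseteq> X" "\<not> T \<subseteq> C"
    and F: "F \<subseteq> star X r T" "\<And>A. A \<in> F \<Longrightarrow> card T \<le> card (A \<inter> C)"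
  shows "(card X - card T) * card F
    \<le> card C * (r - card T) * ((card X - card T) choose (r - card T))"
proof -
  have finC: "finite C" and finT: "finite T"
    using X T C finite_subset by blast+
  have "F \<subseteq> (\<Union>x\<in>C - T. star X r (insert x T))"
  proof
    fix A assume A: "A \<in> F"
    have "\<not> A \<inter> C \<subseteq> T"
    proof
      assume "A \<inter> C \<subseteq> T"
      \<comment> \<open>The inclusion is strict because some element of \<open>T\<close> lies
        outside \<open>C\<close>.\<close>
      then have "A \<inter> C \<subset> T"
        using C by auto
      then have "card (A \<inter> C) < card T"
        using finT psubset_card_mono by blast
      then show False
        using F(2)[OF A] by simp
    qed
    then show "A \<in> (\<Union>x\<in>C - T. star X r (insert x T))"
      using A F(1) by (auto simp: star_def)
  qed
  then have "card F \<le> card (\<Union>x\<in>C - T. star X r (insert x T))"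
    using X finC by (intro card_mono) (auto simp: finite_star)
  also have "\<dots> \<le> (\<Sum>x\<in>C - T. card (star X r (insert x T)))"
    using finC by (intro card_UN_le) auto
  finally have "(card X - card T) * card F
      \<le> (card X - card T) * (\<Sum>x\<in>C - T. card (star X r (insert x T)))"
    by (rule mult_le_mono2)
  also have "\<dots> = (\<Sum>x\<in>C - T. (r - card T) * ((card X - card T) choose (r - card T)))"
    unfolding sum_distrib_left using X T C by (intro sum.cong refl card_star_insert) auto
  also have "\<dots> \<le> card C * ((r - card T) * ((card X - card T) choose (r - card T)))"
    using finC by (simp add: card_mono mult_le_mono1)
  finally show ?thesis
    by (simp add: mult.assoc)
qed

text \<open>Choosing a \<open>t\<close>-subset of \<open>A \<inter> C\<close> for each
  \<open>A\<close> covers \<open>F\<close> by one subfamily per \<open>t\<close>-subset of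
  \<open>C\<close>. The multiplier \<open>k\<close> carries the denominator of the bound on each
  subfamily: 1 for the trivial bound, \<open>card X - t\<close> for the improved one.\<close>

lemma card_le_by_subsets:
  assumes C: "finite C" and F: "finite F" "\<And>A. A \<in> F \<Longrightarrow> t \<le> card (A \<inter> C)"
    and M: "\<And>T. T \<in> nsets C t \<Longrightarrow> k * card {A \<in> F. T \<subseteq> A} \<le> M"
  shows "k * card F \<le> (card C choose t) * M"
proof -
  have "F \<subseteq> (\<Union>T\<in>nsets C t. {A \<in> F. T \<subseteq> A})"
  proof
    fix A assume A: "A \<in> F"
    then obtain T where "T \<subseteq> A \<inter> C" "card T = t" "finite T"
      using F(2) obtain_subset_with_card_n by metis
    then show "A \<in> (\<Union>T\<in>nsets C t. {A \<in> F. T \<subseteq> A})"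
      using A by (auto simp: nsets_def)
  qed
  then have "card F \<le> card (\<Union>T\<in>nsets C t. {A \<in> F. T \<subseteq> A})"
    using C F by (intro card_mono) (auto simp: finite_imp_finite_nsets)
  also have "\<dots> \<le> (\<Sum>T\<in>nsets C t. card {A \<in> F. T \<subseteq> A})"
    using C by (intro card_UN_le) (simp add: finite_imp_finite_nsets)
  finally have "k * card F \<le> (\<Sum>T\<in>nsets C t. k * card {A \<in> F. T \<subseteq> A})"
    by (metis mult_le_mono2 sum_distrib_left)
  also have "\<dots> \<le> (\<Sum>T\<in>nsets C t. M)"
    by (rule sum_mono) (rule M)
  finally show ?thesis
    by (simp add: card_nsets)
qed

section \<open>Bounds on one family of a cross-\<open>t\<close>-intersecting pair\<close>

lemma cross_intersecting_commute:
  "cross_intersecting t \<A> \<B> \<longleftrightarrow> cross_intersecting t \<B> \<A>"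
  unfolding cross_intersecting_def by (metis Int_commute)

context
  fixes X :: "'a set" and r s t :: nat and \<A> \<B> :: "'a set set"
  assumes X: "finite X" and tr: "t \<le> r"
    and A: "\<A> \<subseteq> nsets X r" and B: "\<B> \<subseteq> nsets X s"
    and cross: "cross_intersecting t \<A> \<B>"
begin

text \<open>The union bound over the \<open>t\<close>-subsets of a single member of
  \<open>\<B>\<close>, with the trivial bound on each star. Here and below no order between
  \<open>r\<close> and \<open>s\<close> is imposed, so exchanging the roles gives the bounds on
  \<open>\<B>\<close>.\<close>

lemma cross_card_le:
  assumes "\<B> \<noteq> {}"
  shows "card \<A> \<le> (s choose t) * ((card X - t) choose (r - t))"
proof -
  obtain B0 where B0: "B0 \<in> \<B>"
    using assms by blast
  have "1 * card \<A> \<le> (card B0 choose t) * ((card X - t) choose (r - t))"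
  proof (rule card_le_by_subsets)
    show "finite \<A>"
      using A X finite_subset finite_imp_finite_nsets by blast
    fix T assume T: "T \<in> nsets B0 t"
    then have "T \<subseteq> X" "card T = t"
      using B B0 by (auto simp: nsets_def)
    then show "1 * card {A \<in> \<A>. T \<subseteq> A} \<le> (card X - t) choose (r - t)"
      using A X tr card_star[of X T r] card_mono[of "star X r T" "{A \<in> \<A>. T \<subseteq> A}"]
      by (auto simp: star_def finite_imp_finite_nsets)
  qed (use B B0 cross in \<open>auto simp: nsets_def cross_intersecting_def\<close>)
  moreover have "card B0 = s"
    using B B0 by (auto simp: nsets_def)
  ultimately show ?thesis
    by simp
qed

text \<open>If \<open>T\<close> is a kernel of \<open>\<A>\<close>, this bounds all of
  \<open>\<A>\<close>; otherwise it bounds one term of the union over \<open>t\<close>-sets.\<close>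

lemma cross_card_star_le:
  assumes T: "T \<in> nsets X t" and B0: "B0 \<in> \<B>" "\<not> T \<subseteq> B0"
  shows "(card X - t) * card {A \<in> \<A>. T \<subseteq> A} \<le> s * (r - t) * ((card X - t) choose (r - t))"
proof -
  have "T \<subseteq> X" "card T = t" "B0 \<subseteq> X" "card B0 = s"
    using T B0 B by (auto simp: nsets_def)
  moreover have "{A \<in> \<A>. T \<subseteq> A} \<subseteq> star X r T"
    using A by (auto simp: star_def)
  ultimately show ?thesis
    using card_le_of_not_kernel[of X T r B0 "{A \<in> \<A>. T \<subseteq> A}"] X tr B0 cross
    by (auto simp: cross_intersecting_def)
qed

text \<open>Every \<open>t\<close>-subset of \<open>B0\<close> fails to lie in some member of
  \<open>\<B>\<close>, possibly a different one for each subset, so every term of the union bound is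
  improved.\<close>

lemma cross_card_le_of_no_kernel:
  assumes "\<B> \<noteq> {}" and no: "\<And>T. T \<in> nsets X t \<Longrightarrow> \<exists>B\<in>\<B>. \<not> T \<subseteq> B"
  shows "(card X - t) * card \<A>
    \<le> (s choose t) * (s * (r - t) * ((card X - t) choose (r - t)))"
proof -
  obtain B0 where B0: "B0 \<in> \<B>"
    using assms by blast
  have "(card X - t) * card \<A> \<le> (card B0 choose t) * (s * (r - t) * ((card X - t) choose (r - t)))"
  proof (rule card_le_by_subsets)
    show "finite \<A>"
      using A X finite_subset finite_imp_finite_nsets by blast
    fix T assume T: "T \<in> nsets B0 t"
    then have T: "T \<in> nsets X t"
      using B B0 by (auto simp: nsets_def)
    show "(card X - t) * card {A \<in> \<A>. T \<subseteq> A} \<le> s * (r - t) * ((card X - t) choose (r - t))"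
      using no[OF T] cross_card_star_le[OF T] by blast
  qed (use B B0 cross in \<open>auto simp: nsets_def cross_intersecting_def\<close>)
  moreover have "card B0 = s"
    using B B0 by (auto simp: nsets_def)
  ultimately show ?thesis
    by simp
qed

end

section \<open>Strict inequality without a common kernel\<close>

lemma cross_intersecting_product_less:
  fixes X :: "'a set"
  assumes X: "finite X" and tr: "t \<le> r" and rs: "r \<le> s"
    and P: "r * (s - t) * ((r + s - t) choose t) < card X - t"
    and A: "\<A> \<subseteq> nsets X r" and B: "\<B> \<subseteq> nsets X s"
    and cross: "cross_intersecting t \<A> \<B>"
    and no: "\<And>T. T \<in> nsets X t \<Longrightarrow> \<exists>C\<in>\<A> \<union> \<B>. \<not> T \<subseteq> C"
    and pos: "0 < ((card X - t) choose (r - t)) * ((card X - t) choose (s - t))"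
  shows "card \<A> * card \<B> < ((card X - t) choose (r - t)) * ((card X - t) choose (s - t))"
proof (cases "\<A> = {} \<or> \<B> = {}")
  case True
  then show ?thesis
    using pos by auto
next
  case False
  then have ne: "\<A> \<noteq> {}" "\<B> \<noteq> {}"
    by auto
  define N where "N = card X - t"
  define m1 where "m1 = N choose (r - t)"
  define m2 where "m2 = N choose (s - t)"
  define p where "p = (r + s - t) choose t"
  \<comment> \<open>\<open>q\<close> dominates all four products of \<open>s choose t\<close> or
    \<open>r choose t\<close> with \<open>s * (r - t)\<close> or \<open>r * (s - t)\<close>: both
    binomials are at most \<open>p\<close>, and \<open>r \<le> s\<close> makes
    \<open>r * (s - t)\<close> the larger factor.\<close>
  define q where "q = r * (s - t) * p"
  have ts: "t \<le> s"
    using tr rs by simp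
  have qN: "q < N"
    using P by (simp add: q_def p_def N_def)
  have pos': "0 < m1 * m2"
    using pos by (simp add: m1_def m2_def N_def)
  have cross': "cross_intersecting t \<B> \<A>"
    using cross cross_intersecting_commute by metis
  have cs: "s choose t \<le> p" and cr: "r choose t \<le> p"
    unfolding p_def using tr ts by (auto intro!: binomial_right_mono)
  have swap: "s * (r - t) \<le> r * (s - t)"
    using rs by (simp add: diff_mult_distrib2 mult.commute[of s r] diff_le_mono2)
  have q1: "(s choose t) * (r * (s - t)) \<le> q"
    unfolding q_def using cs by (metis mult.commute mult_le_mono2)
  have q2: "(r choose t) * (s * (r - t)) \<le> q"
    unfolding q_def using mult_le_mono[OF cr swap] by (simp add: mult.commute)
  have q3: "(s choose t) * (s * (r - t)) \<le> q"
    unfolding q_def using mult_le_mono[OF cs swap] by (simp add: mult.commute)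
  have q4: "(r choose t) * (r * (s - t)) \<le> q"
    unfolding q_def using cr by (metis mult.commute mult_le_mono2)
  note bA = cross_card_le[OF X tr A B cross ne(2), folded N_def, folded m1_def]
  note bB = cross_card_le[OF X ts B A cross' ne(1), folded N_def, folded m2_def]
  \<comment> \<open>As \<open>q < N\<close>, each case only has to lose a factor of at most
    \<open>q\<close> while gaining \<open>N\<close> once.\<close>
  have less: "card \<A> * card \<B> < m1 * m2" if "N * (card \<A> * card \<B>) \<le> q * (m1 * m2)"
  proof -
    have "q * (m1 * m2) < N * (m1 * m2)"
      using qN pos' by (rule mult_strict_right_mono)
    with that have "N * (card \<A> * card \<B>) < N * (m1 * m2)"
      by (rule le_less_trans)
    then show ?thesis
      by simp
  qed
  consider (kB) T where "T \<in> nsets X t" "\<forall>B\<in>\<B>. T \<subseteq> B"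
    | (kA) T where "T \<in> nsets X t" "\<forall>A\<in>\<A>. T \<subseteq> A"
    | (no) "\<And>T. T \<in> nsets X t \<Longrightarrow> \<exists>B\<in>\<B>. \<not> T \<subseteq> B" "\<And>T. T \<in> nsets X t \<Longrightarrow> \<exists>A\<in>\<A>. \<not> T \<subseteq> A"
    by blast
  then have "card \<A> * card \<B> < m1 * m2"
  proof cases
    case kB
    \<comment> \<open>\<open>T\<close> is a kernel of \<open>\<B>\<close> but not a common one, so
      some member of \<open>\<A>\<close> misses part of it. The improvement then applies to
      \<open>\<B>\<close>, and the trivial bound suffices for \<open>\<A>\<close>.\<close>
    then obtain A0 where "A0 \<in> \<A>" "\<not> T \<subseteq> A0"
      using no[of T] by blast
    moreover have "{B \<in> \<B>. T \<subseteq> B} = \<B>"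
      using kB by blast
    ultimately have "N * card \<B> \<le> r * (s - t) * m2"
      using cross_card_star_le[OF X ts B A cross' kB(1)] by (simp add: N_def m2_def)
    then have "N * (card \<A> * card \<B>) \<le> ((s choose t) * (r * (s - t))) * (m1 * m2)"
      using mult_le_mono[OF bA] by (fastforce simp: mult_ac)
    also have "\<dots> \<le> q * (m1 * m2)"
      using q1 by (rule mult_le_mono1)
    finally show ?thesis
      by (rule less)
  next
    case kA
    then obtain B0 where "B0 \<in> \<B>" "\<not> T \<subseteq> B0"
      using no[of T] by blast
    moreover have "{A \<in> \<A>. T \<subseteq> A} = \<A>"
      using kA by blast
    ultimately have "N * card \<A> \<le> s * (r - t) * m1"
      using cross_card_star_le[OF X tr A B cross kA(1)] by (simp add: N_def m1_def)
    then have "N * (card \<A> * card \<B>) \<le> ((r choose t) * (s * (r - t))) * (m1 * m2)"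
      using mult_le_mono[OF _ bB] by (fastforce simp: mult_ac)
    also have "\<dots> \<le> q * (m1 * m2)"
      using q2 by (rule mult_le_mono1)
    finally show ?thesis
      by (rule less)
  next
    case no
    have "N * card \<A> \<le> ((s choose t) * (s * (r - t))) * m1"
      using cross_card_le_of_no_kernel[OF X tr A B cross ne(2) no(1)]
      by (simp add: N_def m1_def mult.assoc)
    also have "\<dots> \<le> q * m1"
      using q3 by (rule mult_le_mono1)
    finally have a: "N * card \<A> \<le> q * m1" .
    have "N * card \<B> \<le> ((r choose t) * (r * (s - t))) * m2"
      using cross_card_le_of_no_kernel[OF X ts B A cross' ne(1) no(2)]
      by (simp add: N_def m2_def mult.assoc)
    also have "\<dots> \<le> q * m2"
      using q4 by (rule mult_le_mono1)
    \<comment> \<open>The improvement for \<open>\<B>\<close> is spent on absorbing its binomial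
      factor; the one for \<open>\<A>\<close> still supplies the strict inequality.\<close>
    also have "\<dots> \<le> N * m2"
      using qN by (simp add: mult_le_mono1)
    finally have "card \<B> \<le> m2"
      using qN by simp
    then have "N * (card \<A> * card \<B>) \<le> q * (m1 * m2)"
      using mult_le_mono[OF a] by (simp add: mult.assoc)
    then show ?thesis
      by (rule less)
  qed
  then show ?thesis
    by (simp add: m1_def m2_def N_def)
qed

section \<open>The bound and its equality case on \<open>{1..n}\<close>\<close>

theorem theorem1:
  fixes r s t n :: nat and \<A> \<B> :: "nat set set"
  assumes "1 \<le> t" and "t \<le> r" and "r \<le> s"
    and "n0 r s t \<le> n"
    and "\<A> \<subseteq> nsets {1..n} r" and "\<B> \<subseteq> nsets {1..n} s"
    and "cross_intersecting t \<A> \<B>"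
  shows "card \<A> * card \<B> \<le> ((n - t) choose (r - t)) * ((n - t) choose (s - t)) \<and>
    (card \<A> * card \<B> = ((n - t) choose (r - t)) * ((n - t) choose (s - t)) \<longleftrightarrow>
      (\<exists>T \<in> nsets {1..n} t.
         \<A> = {A \<in> nsets {1..n} r. T \<subseteq> A} \<and> \<B> = {B \<in> nsets {1..n} s. T \<subseteq> B}))"
proof -
  let ?X = "{1..n}"
  let ?m1 = "(n - t) choose (r - t)" and ?m2 = "(n - t) choose (s - t)"
  have P: "r * (s - t) * ((r + s - t) choose t) < n - t"
    \<comment> \<open>The summand \<open>t + 1\<close> in \<open>n0\<close> is what makes this
      inequality strict.\<close>
    using assms(4) unfolding n0_def by linarith
  have "0 < (r + s - t) choose t"
    using assms(2,3) by simp
  then have "1 \<le> (r + s - t) choose t"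
    by linarith
  then have "1 * (s - t) * 1 \<le> r * (s - t) * ((r + s - t) choose t)"
    using assms(1,2) by (intro mult_le_mono) auto
  \<comment> \<open>These inequalities keep both binomials positive; without that, equality could
    not force each family to be a full star.\<close>
  then have st: "s - t \<le> n - t" and rt: "r - t \<le> n - t"
    using P assms(3) by linarith+
  then have pos: "0 < ?m1" "0 < ?m2"
    by simp_all
  have star_card: "card (star ?X r T) = ?m1" "card (star ?X s T) = ?m2"
    if "T \<in> nsets ?X t" for T
    using that assms(2,3) card_star[of ?X T] by (auto simp: nsets_def)
  then have attained: "card \<A> * card \<B> = ?m1 * ?m2"
    if "\<exists>T\<in>nsets ?X t. \<A> = star ?X r T \<and> \<B> = star ?X s T"
    using that by auto
  show ?thesis
    unfolding star_def[symmetric]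
  proof (cases "\<exists>T\<in>nsets ?X t. \<forall>C\<in>\<A> \<union> \<B>. T \<subseteq> C")
    case True
    then obtain T where T: "T \<in> nsets ?X t" and "\<forall>C\<in>\<A> \<union> \<B>. T \<subseteq> C"
      by blast
    then have sub: "\<A> \<subseteq> star ?X r T" "\<B> \<subseteq> star ?X s T"
      using assms(5,6) by (auto simp: star_def)
    have le: "card \<A> \<le> ?m1" "card \<B> \<le> ?m2"
      using card_mono[OF finite_star sub(1)] card_mono[OF finite_star sub(2)] star_card[OF T]
      by auto
    have "\<A> = star ?X r T \<and> \<B> = star ?X s T" if eq: "card \<A> * card \<B> = ?m1 * ?m2"
    proof -
      have "card \<A> = ?m1"
      proof (rule ccontr)
        assume "card \<A> \<noteq> ?m1"
        then have "card \<A> * ?m2 < ?m1 * ?m2"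
          using le(1) pos(2) by (intro mult_strict_right_mono) auto
        moreover have "card \<A> * card \<B> \<le> card \<A> * ?m2"
          using le(2) by (rule mult_le_mono2)
        ultimately show False
          using eq by simp
      qed
      moreover from this have "card \<B> = ?m2"
        using eq pos by simp
      ultimately show ?thesis
        using card_subset_eq[OF finite_star sub(1)] card_subset_eq[OF finite_star sub(2)]
          star_card[OF T] by simp
    qed
    moreover have "card \<A> * card \<B> \<le> ?m1 * ?m2"
      using le by (rule mult_le_mono)
    ultimately show "card \<A> * card \<B> \<le> ?m1 * ?m2 \<and> (card \<A> * card \<B> = ?m1 * ?m2 \<longleftrightarrow>
        (\<exists>T \<in> nsets ?X t. \<A> = star ?X r T \<and> \<B> = star ?X s T))"
      using T attained by metis
  next
    case False
    then have "\<exists>C\<in>\<A> \<union> \<B>. \<not> T \<subseteq> C" if "T \<in> nsets ?X t" for T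
      using that by blast
    moreover have "r * (s - t) * ((r + s - t) choose t) < card ?X - t"
      "0 < ((card ?X - t) choose (r - t)) * ((card ?X - t) choose (s - t))"
      using P pos by simp_all
    ultimately have "card \<A> * card \<B> < ((card ?X - t) choose (r - t)) * ((card ?X - t) choose (s - t))"
      using assms by (intro cross_intersecting_product_less) auto
    then have "card \<A> * card \<B> < ?m1 * ?m2"
      by simp
    then show "card \<A> * card \<B> \<le> ?m1 * ?m2 \<and> (card \<A> * card \<B> = ?m1 * ?m2 \<longleftrightarrow>
        (\<exists>T \<in> nsets ?X t. \<A> = star ?X r T \<and> \<B> = star ?X s T))"
      \<comment> \<open>A pair of full stars on a common \<open>T\<close> would attain the bound, so
        strictness refutes both sides of the equivalence.\<close>
      using attained by linarith
  qed
qed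

end
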